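(* For any integer $k\geq 2$, there exists a finite group $G$ such that $\alpha(G)=2$ and $\gamma(G)\geq k$.
   Context: A subset $D$ of a group $G$ is a determining set of $G$ if the only automorphism of $G$ that fixes every element of $D$ is the identity automorphism. The determining number $\alpha(G)$ is the cardinality of a smallest determining set of $G$ ($\alpha(G)=0$ if $G$ has only the identity automorphism). The generating number $\gamma(G)$ is the cardinality of a smallest generating set of $G$. *)

theory Defs
  imports "HOL-Algebra.Bij" "HOL-Algebra.Generated_Groups"
begin

(* The elements of auto G are extensional functions, so the identity automorphism
   is the identity restricted to the carrier. *)
definition determining_set :: "('a, 'b) monoid_scheme \<Rightarrow> 'a set \<Rightarrow> bool" where
  "determining_set G D \<longleftrightarrow>
     D \<subseteq> carrier G \<and>
     (\<forall>f \<in> auto G. (\<forall>d \<in> D. f d = d) \<longrightarrow> f = (\<lambda>x \<in> carrier G. x))"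

definition generating_set :: "('a, 'b) monoid_scheme \<Rightarrow> 'a set \<Rightarrow> bool" where
  "generating_set G S \<longleftrightarrow> S \<subseteq> carrier G \<and> generate G S = carrier G"

(* Both numbers are natural numbers, hence meaningful only if some finite determining
   (resp. generating) set exists, in particular for every finite group.  Finiteness is
   required explicitly because card of an infinite set is 0. *)
definition determining_number :: "('a, 'b) monoid_scheme \<Rightarrow> nat" where
  "determining_number G = (LEAST n. \<exists>D. determining_set G D \<and> finite D \<and> card D = n)"

definition generating_number :: "('a, 'b) monoid_scheme \<Rightarrow> nat" where
  "generating_number G = (LEAST n. \<exists>S. generating_set G S \<and> finite S \<and> card S = n)"

end

theory Submission
  imports Defs "HOL-Algebra.Weak_Morphisms" "HOL-Number_Theory.Cong"
begin

text \<open>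
  The group is a semidirect product whose automorphisms are controlled by a cyclic normal subgroup,
  while the number of its generators is forced up by a large elementary abelian quotient.
  For odd \<open>N > 1\<close> consider the maps \<open>x \<mapsto> v + e x\<close> of \<open>\<int>/N\<close> with \<open>e\<^sup>2 = 1\<close>, written as pairs
  \<open>(e, v)\<close>.

  Two elements determine every automorphism \<open>f\<close>, namely the translation \<open>r = (1, 1)\<close> and the
  reflection \<open>s = (-1, 0)\<close>. If \<open>f\<close> fixes \<open>r\<close>, it fixes all translations, because they are the powers
  of \<open>r\<close>; hence an element \<open>t = (e, 0)\<close> and its image \<open>f t\<close> act on the translations in the same way,
  that is, \<open>t\<inverse> f(t)\<close> commutes with \<open>r\<close>. If \<open>f\<close> also fixes \<open>s\<close>, then \<open>t\<inverse> f(t)\<close> commutes with \<open>s\<close>,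
  since \<open>t\<close> does. Only the identity commutes with both \<open>r\<close> and \<open>s\<close>: the first condition leaves
  only translations \<open>(1, v)\<close>, the second says \<open>2 v = 0\<close>, and \<open>N\<close> is odd. So \<open>f\<close> fixes the translations and
  all \<open>(e, 0)\<close>, which together generate the group (\<open>determining_pairI\<close>,
  \<open>determining_set_affine_group\<close>).
  Fewer than two elements never suffice in a noncommutative group, because every element is fixed by
  some inner automorphism other than the identity (\<open>card_determining_set_ge_2\<close>).

  The linear part \<open>(e, v) \<mapsto> e\<close> maps the group onto the group of square roots of \<open>1\<close> modulo \<open>N\<close>. It has
  exponent two, so \<open>m\<close> generators yield at most \<open>2\<^sup>m\<close> elements (\<open>card_exponent_2_image_le\<close>). If \<open>N\<close> is
  a product of \<open>k\<close> distinct odd primes, the Chinese remainder theorem provides at least \<open>2\<^sup>k\<close> roots, one for each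
  choice of signs modulo the primes (\<open>card_square_roots_of_one_ge\<close>). Hence at least \<open>k\<close> generators
  are needed.
\<close>

section \<open>Determining sets\<close>

lemma (in group) conjugation_in_auto:
  assumes c: "c \<in> carrier G"
  shows "(\<lambda>x \<in> carrier G. c \<otimes> x \<otimes> inv c) \<in> auto G"
proof -
  have "bij_betw (\<lambda>x. c \<otimes> x \<otimes> inv c) (carrier G) (carrier G)"
    by (rule bij_betwI[where g = "\<lambda>x. inv c \<otimes> x \<otimes> c"])
      (use c in \<open>auto simp: m_assoc inv_solve_left inv_solve_right\<close>,
       simp_all add: m_assoc[symmetric])
  moreover have "(\<lambda>x \<in> carrier G. c \<otimes> x \<otimes> inv c) \<in> hom G G"
    using c by (auto simp: hom_def m_assoc inv_solve_left)
  ultimately show ?thesis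
    by (simp add: auto_def Bij_def cong: bij_betw_cong)
qed

text \<open>
  An element outside the centre is fixed by conjugation with itself, and a central one by any
  conjugation.
\<close>

lemma (in group) card_determining_set_ge_2:
  assumes ab: "a \<in> carrier G" "b \<in> carrier G" "a \<otimes> b \<noteq> b \<otimes> a"
    and D: "determining_set G D" "finite D"
  shows "2 \<le> card D"
proof (rule ccontr)
  assume "\<not> 2 \<le> card D"
  then have "card D \<le> 1" by simp
  then obtain d where d: "D \<subseteq> {d}" "d \<in> carrier G"
    using D by (metis One_nat_def card_le_Suc0_iff_eq determining_set_def empty_subsetI
        insert_iff one_closed subsetI subset_iff)
  \<comment> \<open>Take \<open>c = d\<close> if \<open>d\<close> is not central, and \<open>c = a\<close> otherwise.\<close>
  obtain c x where c: "c \<in> carrier G" "x \<in> carrier G" "c \<otimes> d = d \<otimes> c" "c \<otimes> x \<noteq> x \<otimes> c"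
    using ab d(2) by metis
  let ?f = "\<lambda>x \<in> carrier G. c \<otimes> x \<otimes> inv c"
  have "?f d = d"
    using c d(2) by (simp add: m_assoc)
  then have "?f = (\<lambda>x \<in> carrier G. x)"
    using D(1) d(1) conjugation_in_auto[OF c(1)] unfolding determining_set_def by blast
  then have "c \<otimes> x \<otimes> inv c = x"
    using c(2) by (metis restrict_apply')
  then show False
    using c by (metis inv_solve_right inv_closed m_closed inv_inv)
qed

text \<open>
  Here \<open>T\<close> plays the part of a complement to the normal subgroup generated by \<open>r\<close>, chosen inside the
  centralizer of \<open>s\<close>. An automorphism \<open>f\<close> fixing \<open>r\<close> cannot change how \<open>t \<in> T\<close> conjugates \<open>r\<close>, and one
  fixing \<open>s\<close> keeps \<open>t\<close> in the centralizer of \<open>s\<close>; so \<open>t\<inverse> f(t)\<close> centralizes both \<open>r\<close> and \<open>s\<close>.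
\<close>

lemma (in group) determining_pairI:
  assumes r: "r \<in> carrier G" and s: "s \<in> carrier G"
    and factor: "\<And>g. g \<in> carrier G \<Longrightarrow>
      \<exists>x \<in> generate G {r}. \<exists>t \<in> T. g = x \<otimes> t"
    and T: "\<And>t. t \<in> T \<Longrightarrow> t \<in> carrier G \<and> t \<otimes> s = s \<otimes> t"
    and normalizes: "\<And>t. t \<in> T \<Longrightarrow> \<exists>x \<in> generate G {r}. t \<otimes> r = x \<otimes> t"
    and centralizer: "\<And>z. \<lbrakk>z \<in> carrier G; z \<otimes> r = r \<otimes> z; z \<otimes> s = s \<otimes> z\<rbrakk> \<Longrightarrow> z = \<one>"
  shows "determining_set G {r, s}"
  unfolding determining_set_def
proof (intro conjI ballI impI)
  show "{r, s} \<subseteq> carrier G" using r s by simp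
  fix f assume f: "f \<in> auto G" and "\<forall>d \<in> {r, s}. f d = d"
  then have fr: "f r = r" and fs: "f s = s" by auto
  have f_hom: "f \<in> hom G G" and f_ext: "f \<in> extensional (carrier G)"
    using f by (auto simp: auto_def Bij_def)
  interpret f: group_hom G G f
    by unfold_locales (rule f_hom)
  have in_G: "x \<in> carrier G" if "x \<in> generate G {r}" for x
    using that generate_in_carrier[of "{r}"] r by auto
  have f_gen: "f x = x" if "x \<in> generate G {r}" for x
    using that
  proof induction
    case (eng x y)
    then show ?case using in_G by simp
  qed (use fr r in auto)
  have f_T: "f t = t" if t: "t \<in> T" for t
  proof -
    let ?z = "inv t \<otimes> f t"
    have tG: "t \<in> carrier G" and ts: "t \<otimes> s = s \<otimes> t" using T[OF t] by auto
    have ftG: "f t \<in> carrier G" using tG by simp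
    obtain x where x: "x \<in> generate G {r}" "t \<otimes> r = x \<otimes> t"
      using normalizes[OF t] by blast
    have "f t \<otimes> r = x \<otimes> f t"
      using arg_cong[OF x(2), of f] tG r in_G[OF x(1)] f_gen[OF x(1)] fr by simp
    moreover have "inv t \<otimes> x = r \<otimes> inv t"
      using x tG r in_G[OF x(1)] by (metis inv_closed inv_solve_left inv_solve_right m_assoc m_closed)
    ultimately have zr: "?z \<otimes> r = r \<otimes> ?z"
      using tG ftG r in_G[OF x(1)] by (metis inv_closed m_assoc)
    have "f t \<otimes> s = s \<otimes> f t"
      using arg_cong[OF ts, of f] tG s fs by simp
    moreover have "inv t \<otimes> s = s \<otimes> inv t"
      using ts tG s by (metis inv_closed inv_solve_left inv_solve_right m_assoc m_closed)
    ultimately have zs: "?z \<otimes> s = s \<otimes> ?z"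
      using tG ftG s by (metis inv_closed m_assoc)
    have "?z = \<one>"
      using centralizer[OF _ zr zs] tG ftG by simp
    then show ?thesis
      using tG ftG by (metis inv_equality inv_inv inv_closed)
  qed
  have "f g = g" if g: "g \<in> carrier G" for g
  proof -
    obtain x t where "x \<in> generate G {r}" "t \<in> T" "g = x \<otimes> t"
      using factor[OF g] by blast
    then show ?thesis
      using f_gen f_T T in_G by simp
  qed
  then show "f = (\<lambda>x \<in> carrier G. x)"
    using f_ext by (intro extensionalityI[where A = "carrier G"]) auto
qed

text \<open>
  An automorphism \<open>f\<close> of \<open>H\<close> fixing \<open>h ` D\<close> is pulled back to \<open>h\<inverse> f h\<close>, which fixes \<open>D\<close>. The restriction
  in the proof is needed because elements of \<open>auto G\<close> are extensional.
\<close>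

lemma determining_set_iso:
  assumes G: "group G" and h: "h \<in> iso G H" and D: "determining_set G D"
  shows "determining_set H (h ` D)"
  unfolding determining_set_def
proof (intro conjI ballI impI)
  have DG: "D \<subseteq> carrier G" using D by (simp add: determining_set_def)
  have bij: "bij_betw h (carrier G) (carrier H)" and h_hom: "h \<in> hom G H"
    using h by (auto simp: iso_def)
  show "h ` D \<subseteq> carrier H" using DG bij by (auto simp: bij_betw_def)
  fix f assume f: "f \<in> auto H" and fix_D: "\<forall>d \<in> h ` D. f d = d"
  define k where "k = inv_into (carrier G) h"
  have k: "k \<in> iso H G" unfolding k_def using group.iso_set_sym[OF G h] .
  have kh: "k (h x) = x" if "x \<in> carrier G" for x
    using that bij unfolding k_def by (meson bij_betw_inv_into_left)
  have hk: "h (k y) = y" if "y \<in> carrier H" for y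
    using that bij unfolding k_def by (meson bij_betw_inv_into_right)
  have f_iso: "f \<in> iso H H" and f_ext: "f \<in> extensional (carrier H)"
    using f by (auto simp: auto_def Bij_def iso_def)
  have g_iso: "k \<circ> (f \<circ> h) \<in> iso G G"
    using iso_set_trans[OF iso_set_trans[OF h f_iso] k] by simp
  let ?g = "restrict (k \<circ> (f \<circ> h)) (carrier G)"
  have "?g \<in> auto G"
    using g_iso group.is_monoid[OF G]
    by (auto simp: auto_def Bij_def iso_def hom_def monoid.m_closed cong: bij_betw_cong)
  moreover have "?g d = d" if "d \<in> D" for d
    using that fix_D DG kh by auto
  ultimately have g: "?g = (\<lambda>x \<in> carrier G. x)"
    using D unfolding determining_set_def by blast
  have "f y = y" if y: "y \<in> carrier H" for y
  proof -
    have "k y \<in> carrier G" "f y \<in> carrier H"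
      using y k f_iso by (auto simp: iso_def hom_def)
    moreover from this have "k (f y) = k y"
      using fun_cong[OF g, of "k y"] y hk by simp
    ultimately show ?thesis using hk y by metis
  qed
  then show "f = (\<lambda>x \<in> carrier H. x)"
    using f_ext by (intro extensionalityI[where A = "carrier H"]) auto
qed

section \<open>Generating sets\<close>

text \<open>
  Adjoining a generator \<open>a\<close> to a subgroup \<open>H\<close> at most doubles it: as \<open>{1, a}\<close> is itself a subgroup and the
  group is commutative, the product \<open>H {1, a}\<close> is already closed.
\<close>

lemma (in comm_group) card_generate_exponent_2:
  assumes square: "\<And>x. x \<in> carrier G \<Longrightarrow> x \<otimes> x = \<one>"
    and "finite S" "S \<subseteq> carrier G"
  shows "finite (generate G S) \<and> card (generate G S) \<le> 2 ^ card S"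
  using assms(2,3)
proof (induction S rule: finite_induct)
  case empty
  then show ?case by (simp add: generate_empty)
next
  case (insert a S)
  let ?H = "generate G S"
  have H: "subgroup ?H G" using insert by (simp add: generate_is_subgroup)
  have aG: "a \<in> carrier G" using insert by simp
  have "subgroup {\<one>, a} G"
    using aG square by (intro subgroupI) (auto intro: inv_equality)
  then have "subgroup (?H <#> {\<one>, a}) G"
    using H mult_subgroups by blast
  moreover have "insert a S \<subseteq> ?H <#> {\<one>, a}"
  proof
    fix x assume "x \<in> insert a S"
    then show "x \<in> ?H <#> {\<one>, a}"
    proof
      assume "x = a"
      then have "x = \<one> \<otimes> a" using aG by simp
      then show ?thesis
        unfolding set_mult_def using subgroup.one_closed[OF H] by blast
    next
      assume x: "x \<in> S"
      then have "x = x \<otimes> \<one>" "x \<in> ?H"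
        using insert by (auto intro: generate.incl)
      then show ?thesis unfolding set_mult_def by blast
    qed
  qed
  ultimately have "generate G (insert a S) \<subseteq> ?H <#> {\<one>, a}"
    by (rule generate_subgroup_incl[rotated])
  also have "\<dots> = (\<lambda>(x, y). x \<otimes> y) ` (?H \<times> {\<one>, a})"
    by (auto simp: set_mult_def)
  finally have sub: "generate G (insert a S) \<subseteq> (\<lambda>(x, y). x \<otimes> y) ` (?H \<times> {\<one>, a})" .
  have fin: "finite (?H \<times> {\<one>, a})" using insert by simp
  have "card (generate G (insert a S)) \<le> card (?H \<times> {\<one>, a})"
    by (rule surj_card_le[OF fin sub])
  also have "\<dots> \<le> 2 ^ card S * 2"
    unfolding card_cartesian_product using insert by (intro mult_mono) (auto simp: card_insert_if)
  finally show ?case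
    using insert finite_subset[OF sub finite_imageI[OF fin]] by simp
qed

text \<open>
  The generating number is bounded from below through a quotient: the image of a generating set
  generates the image, and a group in which every element is its own inverse is commutative.
\<close>

lemma (in group_hom) card_exponent_2_image_le:
  assumes square: "\<And>y. y \<in> carrier H \<Longrightarrow> y \<otimes>\<^bsub>H\<^esub> y = \<one>\<^bsub>H\<^esub>"
    and surj: "h ` carrier G = carrier H"
    and S: "generating_set G S" "finite S"
  shows "card (carrier H) \<le> 2 ^ card S"
proof -
  have "comm_group H"
  proof (rule H.group_comm_groupI)
    fix x y assume xy: "x \<in> carrier H" "y \<in> carrier H"
    have inv_self: "inv\<^bsub>H\<^esub> z = z" if "z \<in> carrier H" for z
      using that square by (simp add: H.inv_equality)
    show "x \<otimes>\<^bsub>H\<^esub> y = y \<otimes>\<^bsub>H\<^esub> x"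
      using H.inv_mult_group[OF xy] xy by (simp add: inv_self)
  qed
  then interpret A: comm_group H .
  have SG: "S \<subseteq> carrier G" "generate G S = carrier G"
    using S by (auto simp: generating_set_def)
  then have "generate H (h ` S) = carrier H"
    using generate_img surj by simp
  then have "card (carrier H) \<le> 2 ^ card (h ` S)"
    using A.card_generate_exponent_2[OF square, of "h ` S"] S(2) SG(1) by (metis finite_imageI
        hom_closed image_subsetI subset_iff)
  also have "\<dots> \<le> 2 ^ card S"
    using S(2) by (simp add: card_image_le)
  finally show ?thesis .
qed

section \<open>Affine maps with involutive linear part\<close>

definition square_roots_of_one :: "int \<Rightarrow> int set" where
  "square_roots_of_one N = {e. 0 \<le> e \<and> e < N \<and> e * e mod N = 1}"

definition root_group :: "int \<Rightarrow> int monoid" where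
  "root_group N = \<lparr>carrier = square_roots_of_one N, monoid.mult = \<lambda>d e. d * e mod N, one = 1\<rparr>"

text \<open>
  The pair \<open>(e, v)\<close> stands for the map \<open>x \<mapsto> v + e x\<close> on the integers modulo \<open>N\<close>, and the product is
  composition of maps. For an odd prime \<open>N\<close> this is the dihedral group of order \<open>2 N\<close>.
\<close>

definition affine_group :: "int \<Rightarrow> (int \<times> int) monoid" where
  "affine_group N =
    \<lparr>carrier = square_roots_of_one N \<times> {0..<N},
     monoid.mult = \<lambda>(d, v) (e, w). (d * e mod N, (v + d * w) mod N),
     one = (1, 0)\<rparr>"

lemma square_roots_of_one_mult:
  assumes "N > 1" "d \<in> square_roots_of_one N" "e \<in> square_roots_of_one N"
  shows "d * e mod N \<in> square_roots_of_one N"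
proof -
  have "(d * e) * (d * e) mod N = ((d * d mod N) * (e * e mod N)) mod N"
    by (simp add: mod_mult_eq ac_simps)
  also have "\<dots> = 1"
    using assms by (simp add: square_roots_of_one_def)
  finally show ?thesis
    using assms(1) by (simp add: square_roots_of_one_def mod_simps)
qed

lemma one_in_square_roots_of_one: "N > 1 \<Longrightarrow> 1 \<in> square_roots_of_one N"
  by (simp add: square_roots_of_one_def)

lemma minus_one_in_square_roots_of_one:
  assumes "N > 1" shows "N - 1 \<in> square_roots_of_one N"
proof -
  have "(N - 1) * (N - 1) = 1 + N * (N - 2)" by (simp add: algebra_simps)
  then show ?thesis using assms by (simp add: square_roots_of_one_def)
qed

lemma group_root_group:
  assumes "N > 1" shows "group (root_group N)"
proof (rule groupI)
  show "\<exists>y\<in>carrier (root_group N). y \<otimes>\<^bsub>root_group N\<^esub> x = \<one>\<^bsub>root_group N\<^esub>"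
    if "x \<in> carrier (root_group N)" for x
    using that by (auto simp: root_group_def square_roots_of_one_def)
qed (use assms in \<open>auto simp: root_group_def square_roots_of_one_mult one_in_square_roots_of_one
      mod_simps ac_simps, auto simp: square_roots_of_one_def\<close>)

lemma add_mult_mod_eq:
  fixes N :: int
  shows "(v + d * (w mod N)) mod N = (v + d * w) mod N"
    and "(v + (d mod N) * w) mod N = (v + d * w) mod N"
  by (metis mod_add_right_eq mod_mult_right_eq, metis mod_add_right_eq mod_mult_left_eq)

lemma group_affine_group:
  assumes N: "N > 1" shows "group (affine_group N)"
proof (rule groupI)
  fix x assume "x \<in> carrier (affine_group N)"
  then obtain e v where x: "x = (e, v)" "e \<in> square_roots_of_one N" "0 \<le> v" "v < N"
    by (auto simp: affine_group_def)
  then show "\<one>\<^bsub>affine_group N\<^esub> \<otimes>\<^bsub>affine_group N\<^esub> x = x"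
    by (simp add: affine_group_def square_roots_of_one_def)
  have "(e, (- e * v) mod N) \<in> carrier (affine_group N)"
    using x N by (simp add: affine_group_def)
  moreover have "(e, (- e * v) mod N) \<otimes>\<^bsub>affine_group N\<^esub> x = \<one>\<^bsub>affine_group N\<^esub>"
    using x by (simp add: affine_group_def square_roots_of_one_def mod_simps)
  ultimately show "\<exists>y\<in>carrier (affine_group N). y \<otimes>\<^bsub>affine_group N\<^esub> x = \<one>\<^bsub>affine_group N\<^esub>"
    by blast
next
  fix x y z
  assume "x \<in> carrier (affine_group N)" "y \<in> carrier (affine_group N)" "z \<in> carrier (affine_group N)"
  show "x \<otimes>\<^bsub>affine_group N\<^esub> y \<otimes>\<^bsub>affine_group N\<^esub> z = x \<otimes>\<^bsub>affine_group N\<^esub> (y \<otimes>\<^bsub>affine_group N\<^esub> z)"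
    by (cases x; cases y; cases z)
      (simp add: affine_group_def mod_simps add_mult_mod_eq, simp add: algebra_simps)
qed (use N in \<open>auto simp: affine_group_def square_roots_of_one_mult one_in_square_roots_of_one\<close>)

lemma finite_affine_group: "finite (carrier (affine_group N))"
proof -
  have "square_roots_of_one N \<subseteq> {0..<N}" by (auto simp: square_roots_of_one_def)
  then show ?thesis by (simp add: affine_group_def finite_subset)
qed

lemma translation_in_generate:
  assumes N: "N > 1" and v: "0 \<le> v" "v < N"
  shows "(1, v) \<in> generate (affine_group N) {(1, 1)}"
proof -
  interpret group "affine_group N" using N by (rule group_affine_group)
  have "(1, int n mod N) \<in> generate (affine_group N) {(1, 1)}" for n
  proof (induction n)
    case 0
    then show ?case using generate.one[of "affine_group N"] by (simp add: affine_group_def)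
  next
    case (Suc n)
    have "(1, int n mod N) \<otimes>\<^bsub>affine_group N\<^esub> (1, 1) \<in> generate (affine_group N) {(1, 1)}"
      by (rule generate.eng[OF Suc generate.incl]) simp
    then show ?case using N by (simp add: affine_group_def mod_simps add.commute)
  qed
  from this[of "nat v"] show ?thesis using v by simp
qed

lemma odd_double_mod_eq:
  fixes N :: int
  assumes "odd N" "0 \<le> v" "v < N" "v mod N = (- v) mod N"
  shows "v = 0"
proof -
  have "N dvd 2 * v" using assms(4) by (simp add: mod_eq_dvd_iff)
  then have "N dvd v" using assms(1) by (simp add: coprime_dvd_mult_right_iff)
  then show ?thesis using assms(2,3) by (meson not_less zdvd_not_zless order_le_less)
qed

text \<open>
  The criterion is applied with \<open>T\<close> the group of the maps \<open>x \<mapsto> e x\<close>; the reflection \<open>(-1, 0)\<close> is written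
  with the representative \<open>N - 1\<close>. Oddness of \<open>N\<close> enters in the centralizer: a translation commuting
  with the reflection satisfies \<open>v = - v\<close>.
\<close>

lemma determining_set_affine_group:
  assumes N: "N > 1" "odd N"
  shows "determining_set (affine_group N) {(1, 1), (N - 1, 0)}"
proof -
  interpret group "affine_group N" using N(1) by (rule group_affine_group)
  have neg: "((N - 1) * x) mod N = (- x) mod N" "(x * (N - 1)) mod N = (- x) mod N" for x
  proof -
    have "(N - 1) * x = - x + N * x" by (simp add: algebra_simps)
    then show "((N - 1) * x) mod N = (- x) mod N" by (simp only: mod_mult_self2)
    then show "(x * (N - 1)) mod N = (- x) mod N" by (simp add: mult.commute)
  qed
  note minus = minus_one_in_square_roots_of_one[OF N(1)] one_in_square_roots_of_one[OF N(1)]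
  show ?thesis
  proof (rule determining_pairI[where T = "square_roots_of_one N \<times> {0::int}"])
    show "(1, 1) \<in> carrier (affine_group N)" "(N - 1, 0) \<in> carrier (affine_group N)"
      using N minus by (auto simp: affine_group_def)
  next
    fix g assume "g \<in> carrier (affine_group N)"
    then obtain e v where g: "g = (e, v)" "e \<in> square_roots_of_one N" "0 \<le> v" "v < N"
      by (auto simp: affine_group_def)
    then have "g = (1, v) \<otimes>\<^bsub>affine_group N\<^esub> (e, 0)"
      by (simp add: affine_group_def square_roots_of_one_def)
    then show "\<exists>x \<in> generate (affine_group N) {(1, 1)}. \<exists>t \<in> square_roots_of_one N \<times> {0::int}.
        g = x \<otimes>\<^bsub>affine_group N\<^esub> t"
      using translation_in_generate[OF N(1) g(3,4)] g(2) by blast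
  next
    fix t assume t: "t \<in> square_roots_of_one N \<times> {0::int}"
    then show "t \<in> carrier (affine_group N) \<and>
        t \<otimes>\<^bsub>affine_group N\<^esub> (N - 1, 0) = (N - 1, 0) \<otimes>\<^bsub>affine_group N\<^esub> t"
      using N by (auto simp: affine_group_def mult.commute)
    obtain e where e: "t = (e, 0)" "0 \<le> e" "e < N"
      using t by (auto simp: square_roots_of_one_def)
    then have "t \<otimes>\<^bsub>affine_group N\<^esub> (1, 1) = (1, e) \<otimes>\<^bsub>affine_group N\<^esub> t"
      by (simp add: affine_group_def)
    then show "\<exists>x \<in> generate (affine_group N) {(1, 1)}.
        t \<otimes>\<^bsub>affine_group N\<^esub> (1, 1) = x \<otimes>\<^bsub>affine_group N\<^esub> t"
      using translation_in_generate[OF N(1) e(2,3)] by blast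
  next
    fix z assume z: "z \<in> carrier (affine_group N)"
      and zr: "z \<otimes>\<^bsub>affine_group N\<^esub> (1, 1) = (1, 1) \<otimes>\<^bsub>affine_group N\<^esub> z"
      and zs: "z \<otimes>\<^bsub>affine_group N\<^esub> (N - 1, 0) = (N - 1, 0) \<otimes>\<^bsub>affine_group N\<^esub> z"
    obtain e v where ev: "z = (e, v)" "0 \<le> e" "e < N" "0 \<le> v" "v < N"
      using z by (auto simp: affine_group_def square_roots_of_one_def)
    have "(v + e) mod N = (v + 1) mod N"
      using zr ev by (simp add: affine_group_def add.commute)
    then have "e mod N = 1 mod N"
      by (simp add: mod_eq_dvd_iff)
    then have "e = 1" using ev N by simp
    moreover have "v = 0"
      using odd_double_mod_eq[OF N(2) ev(4,5)] zs ev by (simp add: affine_group_def neg)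
    ultimately show "z = \<one>\<^bsub>affine_group N\<^esub>"
      using ev by (simp add: affine_group_def)
  qed
qed

lemma affine_group_not_commutative:
  assumes N: "N > 1" "odd N"
  shows "(1, 1) \<otimes>\<^bsub>affine_group N\<^esub> (N - 1, 0) \<noteq> (N - 1, 0) \<otimes>\<^bsub>affine_group N\<^esub> (1, 1)"
proof -
  have "N \<noteq> 2" using N(2) by auto
  then show ?thesis using N by (simp add: affine_group_def zmod_minus1)
qed

lemma linear_part_hom:
  assumes "N > 1" shows "group_hom (affine_group N) (root_group N) fst"
  using group_affine_group[OF assms] group_root_group[OF assms]
  by (auto simp: group_hom_def group_hom_axioms_def hom_def affine_group_def root_group_def)

section \<open>Many square roots of one\<close>

text \<open>
  Every subset \<open>S\<close> of \<open>P\<close> gives a root: the residue that is \<open>1\<close> modulo the primes in \<open>S\<close> and \<open>-1\<close> modulo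
  the others. Different subsets give different roots because \<open>1\<close> and \<open>-1\<close> differ modulo an odd prime.
\<close>

lemma card_square_roots_of_one_ge:
  assumes P: "finite P" "\<And>p. p \<in> P \<Longrightarrow> prime p \<and> p > 2" "P \<noteq> {}"
  shows "2 ^ card P \<le> card (square_roots_of_one (int (\<Prod>P)))"
proof -
  define n where "n = \<Prod>P"
  have cop: "coprime p q" if "p \<in> P" "q \<in> P" "p \<noteq> q" for p q
    using that P by (simp add: primes_coprime)
  have n_pos: "n > 0"
    unfolding n_def using P(2) by (intro prod_pos) (auto simp: prime_gt_0_nat)
  have p_dvd: "p dvd n" if "p \<in> P" for p
    unfolding n_def using that P(1) by (rule dvd_prodI[where f = "\<lambda>p. p", rotated])
  have n_gt: "n > 1"
    using P(3) p_dvd P(2) n_pos by (metis all_not_in_conv dvd_imp_le less_le_trans one_less_numeral_iff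
        order_less_trans semiring_norm(76))
  have "\<exists>x. \<forall>p \<in> P. [x = (if p \<in> S then 1 else p - 1)] (mod p)" for S
    using chinese_remainder_nat[OF P(1), where m = "\<lambda>p. p"
        and u = "\<lambda>p. if p \<in> S then 1 else p - 1"] cop by blast
  then obtain x where x: "\<And>S p. p \<in> P \<Longrightarrow> [x S = (if p \<in> S then 1 else p - 1)] (mod p)"
    by metis
  let ?e = "\<lambda>S. int (x S mod n)"
  have "?e S \<in> square_roots_of_one (int n)" for S
  proof -
    have "[x S * x S = 1] (mod p)" if p: "p \<in> P" for p
    proof -
      have "[x S * x S = (if p \<in> S then 1 else (p - 1) * (p - 1))] (mod p)"
        using cong_mult[OF x[OF p, of S] x[OF p, of S]] by (auto split: if_splits)
      moreover have "(p - 1) * (p - 1) = 1 + p * (p - 2)"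
      proof -
        obtain m where "p = m + 2" using P(2)[OF p] by (metis add.commute le_Suc_ex less_imp_le)
        then show ?thesis by simp
      qed
      then have "[(p - 1) * (p - 1) = 1] (mod p)" by (simp only: cong_def mod_mult_self2)
      ultimately show ?thesis by (auto split: if_splits intro: cong_trans)
    qed
    then have "[x S * x S = 1] (mod n)"
      unfolding n_def using cop by (intro coprime_cong_prod_nat[where m = "\<lambda>p. p"]) auto
    then have "x S * x S mod n = 1" using n_gt by (simp add: cong_def)
    then have "(x S mod n) * (x S mod n) mod n = 1" by (simp add: mod_simps)
    then show ?thesis
      using n_gt unfolding square_roots_of_one_def
      by (auto simp flip: of_nat_mult of_nat_mod)
  qed
  moreover have "inj_on ?e (Pow P)"
  proof (rule inj_onI)
    fix S T assume ST: "S \<in> Pow P" "T \<in> Pow P" "?e S = ?e T"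
    have "p \<in> S \<longleftrightarrow> p \<in> T" if p: "p \<in> P" for p
    proof -
      have "[x S = x T] (mod n)" using ST(3) by (simp add: cong_def)
      then have "[x S = x T] (mod p)" using p_dvd[OF p] by (rule cong_dvd_modulus_nat)
      then have "[(if p \<in> S then 1 else p - 1) = (if p \<in> T then 1 else p - 1)] (mod p)"
        using x[OF p] by (metis cong_sym cong_trans)
      moreover have "1 mod p \<noteq> (p - 1) mod p" using P(2)[OF p] by auto
      ultimately show ?thesis by (metis cong_def)
    qed
    then show "S = T" using ST(1,2) by blast
  qed
  moreover have "finite (square_roots_of_one (int n))"
    by (rule finite_subset[of _ "{0..<int n}"]) (auto simp: square_roots_of_one_def)
  ultimately have "card (Pow P) \<le> card (square_roots_of_one (int n))"
    by (intro card_inj_on_le[where f = ?e]) auto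
  then show ?thesis using P(1) by (simp add: card_Pow n_def)
qed

lemma odd_modulus_with_many_square_roots_of_one:
  assumes "k > 0"
  shows "\<exists>N::int. N > 1 \<and> odd N \<and> 2 ^ k \<le> card (square_roots_of_one N)"
proof -
  have "infinite ({p::nat. prime p} - {..2})" using primes_infinite by simp
  then obtain P :: "nat set" where P: "finite P" "card P = k" "P \<subseteq> {p. prime p} - {..2}"
    by (meson infinite_arbitrarily_large)
  have pr: "prime p \<and> p > 2" if "p \<in> P" for p using P(3) that by auto
  have "odd (\<Prod>P)"
    using P(1) pr prime_odd_nat by (auto simp: prime_dvd_prod_iff even_prod_iff)
  moreover have card: "2 ^ k \<le> card (square_roots_of_one (int (\<Prod>P)))"
    using card_square_roots_of_one_ge[OF P(1) pr] P(2) assms by fastforce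
  moreover have "\<Prod>P > 1"
  proof -
    have "P \<noteq> {}" using P assms by auto
    then obtain p where "p \<in> P" by blast
    then have "p dvd \<Prod>P" using P(1) by (rule dvd_prodI[where f = "\<lambda>p. p", rotated])
    moreover have "\<Prod>P > 0" using pr by (intro prod_pos) (auto simp: prime_gt_0_nat)
    ultimately show ?thesis using pr[OF \<open>p \<in> P\<close>] dvd_imp_le[of p "\<Prod>P"] by linarith
  qed
  ultimately show ?thesis
    by (intro exI[of _ "int (\<Prod>P)"]) (auto simp flip: of_nat_prod)
qed

section \<open>Determining number two and large generating number\<close>

theorem theorem6p3:
  fixes k :: int
  assumes "k \<ge> 2"
  shows "\<exists>G :: nat monoid. group G \<and> finite (carrier G) \<and>
           determining_number G = 2 \<and> int (generating_number G) \<ge> k"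
proof -
  obtain N :: int where N: "N > 1" "odd N" "2 ^ nat k \<le> card (square_roots_of_one N)"
    using odd_modulus_with_many_square_roots_of_one[of "nat k"] assms by auto
  let ?A = "affine_group N"
  interpret A: group ?A using N(1) by (rule group_affine_group)
  obtain h :: "int \<times> int \<Rightarrow> nat" where inj: "inj_on h (carrier ?A)"
    using finite_imp_inj_to_nat_seg[OF finite_affine_group] by metis
  \<comment> \<open>The carrier is renamed along an injection, to obtain an isomorphic group of natural numbers.\<close>
  define G where "G = image_group h ?A"
  have iso: "h \<in> iso ?A G" unfolding G_def using inj by (rule inj_imp_image_group_iso)
  interpret G: group G unfolding G_def using inj by (rule A.inj_imp_image_group_is_group)
  have fin: "finite (carrier G)"
    by (simp add: G_def image_group_carrier finite_affine_group)

  let ?r = "(1, 1)" and ?s = "(N - 1, 0)"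
  have rs: "?r \<in> carrier ?A" "?s \<in> carrier ?A"
    using determining_set_affine_group[OF N(1,2)] by (auto simp: determining_set_def)
  have det: "determining_set G {h ?r, h ?s}"
    using determining_set_iso[OF A.group_axioms iso determining_set_affine_group[OF N(1,2)]] by simp
  have h_mult: "h x \<otimes>\<^bsub>G\<^esub> h y = h (x \<otimes>\<^bsub>?A\<^esub> y)" if "x \<in> carrier ?A" "y \<in> carrier ?A" for x y
    using that iso by (simp add: iso_def hom_def)
  have "h ?r \<otimes>\<^bsub>G\<^esub> h ?s \<noteq> h ?s \<otimes>\<^bsub>G\<^esub> h ?r"
    using affine_group_not_commutative[OF N(1,2)] rs inj
    by (simp add: h_mult inj_on_eq_iff)
  moreover have "h ?r \<in> carrier G" "h ?s \<in> carrier G"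
    using det by (auto simp: determining_set_def)
  ultimately have lower: "2 \<le> card D" if "determining_set G D" "finite D" for D
    using G.card_determining_set_ge_2 that by blast
  \<comment> \<open>The two elements are distinct, as otherwise the determining set would be too small.\<close>
  have "card {h ?r, h ?s} = 2"
    using lower[OF det] card_insert_le_m1[of 2 "{h ?s}" "h ?r"] by simp
  then have "determining_number G = 2"
    unfolding determining_number_def
    by (intro Least_equality) (use det lower in \<open>auto intro!: exI[of _ "{h ?r, h ?s}"]\<close>)

  moreover have "nat k \<le> generating_number G"
  proof -
    obtain k' where k': "k' \<in> iso G ?A" using A.iso_set_sym[OF iso] by blast
    have "group_hom G (root_group N) (fst \<circ> k')"
      using linear_part_hom[OF N(1)] k' G.group_axioms
      by (auto simp: group_hom_def group_hom_axioms_def iso_def intro: Group.hom_compose)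
    then interpret q: group_hom G "root_group N" "fst \<circ> k'" .
    have "fst ` carrier ?A = carrier (root_group N)"
      using N(1) by (auto simp: affine_group_def root_group_def)
    then have surj: "(fst \<circ> k') ` carrier G = carrier (root_group N)"
      using k' unfolding image_comp[symmetric] by (simp add: iso_def bij_betw_def)
    have "nat k \<le> card S" if "generating_set G S" "finite S" for S
    proof -
      have "card (carrier (root_group N)) \<le> 2 ^ card S"
        using surj that
        by (intro q.card_exponent_2_image_le) (auto simp: root_group_def square_roots_of_one_def)
      with N(3) have "(2::nat) ^ nat k \<le> 2 ^ card S"
        unfolding root_group_def partial_object.simps by (rule order_trans)
      then show ?thesis by simp
    qed
    moreover have "generating_set G (carrier G)"
      unfolding generating_set_def using G.generate_incl[of "carrier G"] 
      by (auto intro: generate.incl)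
    ultimately show ?thesis
      unfolding generating_number_def
      by (smt (verit, best) LeastI_ex fin)
  qed
  ultimately show ?thesis
    using G.group_axioms fin assms by (intro exI[of _ G]) auto
qed

end
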